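(* For all positive integers $t,N,q$, $f_N^*(q,tN-N,t)\le p_t(N,q)$. Furthermore, $\frac{N!}{N^N}f_N(Nq,tN-N,t)\le p_t(N,q)$.
   Context: A $PHF(N;n,q,t)$ is an $N\times n$ matrix over $[q]$ such that for every set of $t$ columns there is a row in which these $t$ columns have pairwise distinct entries; $p_t(N,q)$ is the maximum such $n$. An $r$-uniform hypergraph is $G(v,e)$-free if the union of any $e$ distinct edges has at least $v+1$ vertices. $f_r(n,v,e)$ is the maximum number of edges of a $G(v,e)$-free $r$-uniform hypergraph on $n$ vertices, and $f_r^*(q,v,e)$ is the maximum number of edges of a $G(v,e)$-free $r$-uniform $r$-partite hypergraph whose $r$ parts each have exactly $q$ vertices (each edge meeting each part in exactly one vertex). *)

theory Defs
  imports "HOL-Library.Extended_Real" "HOL-Library.Disjoint_Sets"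
begin

text \<open>Rows are indexed by \<open>{..<N}\<close>, columns by \<open>{..<n}\<close>; a set of columns is a set of
  column indices, so repeated columns are allowed.\<close>

definition PHF :: "nat \<Rightarrow> nat \<Rightarrow> nat \<Rightarrow> nat \<Rightarrow> (nat \<Rightarrow> nat \<Rightarrow> nat) \<Rightarrow> bool" where
  "PHF N n q t M \<longleftrightarrow>
     (\<forall>i<N. \<forall>j<n. M i j \<in> {1..q}) \<and>
     (\<forall>T. T \<subseteq> {..<n} \<and> card T = t \<longrightarrow> (\<exists>i<N. inj_on (M i) T))"

text \<open>For \<open>t = 1\<close> the admissible \<open>n\<close> are unbounded and the value is \<open>\<infinity>\<close>; for \<open>t \<ge> 2\<close> it is the
  maximum, see \<open>phf_max_eq_Max\<close>.\<close>

definition phf_max :: "nat \<Rightarrow> nat \<Rightarrow> nat \<Rightarrow> enat" where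
  "phf_max t N q = Sup {enat n |n. \<exists>M. PHF N n q t M}"

definition uniform_hypergraph :: "nat \<Rightarrow> 'a set \<Rightarrow> 'a set set \<Rightarrow> bool" where
  "uniform_hypergraph r V E \<longleftrightarrow> finite V \<and> (\<forall>A\<in>E. A \<subseteq> V \<and> card A = r)"

definition G_free :: "nat \<Rightarrow> nat \<Rightarrow> 'a set set \<Rightarrow> bool" where
  "G_free v e E \<longleftrightarrow> (\<forall>S. S \<subseteq> E \<and> finite S \<and> card S = e \<longrightarrow> v + 1 \<le> card (\<Union>S))"

definition equipartite_hypergraph :: "nat \<Rightarrow> nat \<Rightarrow> (nat \<Rightarrow> 'a set) \<Rightarrow> 'a set set \<Rightarrow> bool" where
  "equipartite_hypergraph r q P E \<longleftrightarrow>
     disjoint_family_on P {..<r} \<and>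
     (\<forall>i<r. card (P i) = q) \<and>
     uniform_hypergraph r (\<Union>i<r. P i) E \<and>
     (\<forall>A\<in>E. \<forall>i<r. card (A \<inter> P i) = 1)"

definition f_max :: "nat \<Rightarrow> nat \<Rightarrow> nat \<Rightarrow> nat \<Rightarrow> nat" where
  "f_max r n v e = Max {card E |(V :: nat set) E.
     card V = n \<and> uniform_hypergraph r V E \<and> G_free v e E}"

definition f_star_max :: "nat \<Rightarrow> nat \<Rightarrow> nat \<Rightarrow> nat \<Rightarrow> nat" where
  "f_star_max r q v e = Max {card E |(P :: nat \<Rightarrow> nat set) E.
     equipartite_hypergraph r q P E \<and> G_free v e E}"

lemma card_uniform_hypergraph_le:
  assumes "uniform_hypergraph r V E"
  shows "card E \<le> 2 ^ card V"
proof -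
  have "E \<subseteq> Pow V" "finite V" using assms by (auto simp: uniform_hypergraph_def)
  then show ?thesis by (metis card_Pow card_mono finite_Pow_iff)
qed

lemma finite_f_max_set:
  "finite {card E |(V :: nat set) E. card V = n \<and> uniform_hypergraph r V E \<and> G_free v e E}"
  by (rule finite_subset[of _ "{..2 ^ n}"]) (auto dest: card_uniform_hypergraph_le)

lemma finite_f_star_max_set:
  "finite {card E |(P :: nat \<Rightarrow> nat set) E. equipartite_hypergraph r q P E \<and> G_free v e E}"
proof -
  have le: "card E \<le> 2 ^ (r * q)" if a: "equipartite_hypergraph r q P E"
    for P :: "nat \<Rightarrow> nat set" and E
  proof -
    have "card (\<Union>i<r. P i) \<le> (\<Sum>i<r. card (P i))" by (rule card_UN_le) simp
    also have "\<dots> = r * q" using a by (simp add: equipartite_hypergraph_def)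
    finally have "(2::nat) ^ card (\<Union>i<r. P i) \<le> 2 ^ (r * q)" by (simp add: power_increasing)
    moreover have "card E \<le> 2 ^ card (\<Union>i<r. P i)"
      using a by (intro card_uniform_hypergraph_le[of r]) (simp add: equipartite_hypergraph_def)
    ultimately show ?thesis by (rule le_trans[rotated])
  qed
  show ?thesis by (rule finite_subset[of _ "{..2 ^ (r * q)}"]) (auto dest: le)
qed

lemma PHF_bound:
  assumes "2 \<le> t" "PHF N n q t M"
  shows "n \<le> t + q ^ N"
proof (rule ccontr)
  assume "\<not> n \<le> t + q ^ N"
  then have n: "t \<le> n" "q ^ N < n" by auto
  let ?c = "\<lambda>j. map (\<lambda>i. M i j) [0..<N]"
  let ?W = "{xs. set xs \<subseteq> {1..q} \<and> length xs = N}"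
  have sub: "?c ` {..<n} \<subseteq> ?W" using assms(2) by (auto simp: PHF_def)
  have W: "card ?W = q ^ N" using card_lists_length_eq[of "{1..q}" N] by simp
  have "finite ?W" by (rule finite_lists_length_eq) simp
  then have "card (?c ` {..<n}) \<le> q ^ N" using card_mono[OF _ sub] W by metis
  then have "\<not> inj_on ?c {..<n}" using n card_image[of ?c "{..<n}"] by auto
  then obtain a b where ab: "a < n" "b < n" "a \<noteq> b" "?c a = ?c b"
    by (auto simp: inj_on_def)
  have "\<exists>T. {a, b} \<subseteq> T \<and> T \<subseteq> {..<n} \<and> card T = t"
    using exists_subset_between[of "{a, b}" t "{..<n}"] ab n assms(1) by auto
  then obtain T where T: "{a, b} \<subseteq> T" "T \<subseteq> {..<n}" "card T = t" by blast
  then obtain i where "i < N" "inj_on (M i) T" using assms(2) by (auto simp: PHF_def)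
  moreover have "M i a = M i b" using ab(4) \<open>i < N\<close> by (simp add: list_eq_iff_nth_eq)
  ultimately show False using T(1) ab(3) by (auto simp: inj_on_def)
qed

lemma phf_max_eq_Max:
  assumes "2 \<le> t"
  shows "phf_max t N q = enat (Max {n. \<exists>M. PHF N n q t M})"
proof -
  let ?A = "{n. \<exists>M. PHF N n q t M}"
  have fin: "finite ?A"
    by (rule finite_subset[of _ "{..t + q ^ N}"]) (use PHF_bound[OF assms] in auto)
  have "PHF N 0 q t M" for M using assms by (auto simp: PHF_def)
  then have ne: "?A \<noteq> {}" by blast
  have "phf_max t N q = Sup (enat ` ?A)" unfolding phf_max_def by (rule arg_cong[of _ _ Sup]) auto
  also have "\<dots> = enat (Max ?A)"
  proof (rule antisym)
    show "Sup (enat ` ?A) \<le> enat (Max ?A)" using fin by (intro SUP_least) (auto intro!: Max_ge)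
    show "enat (Max ?A) \<le> Sup (enat ` ?A)" using Max_in[OF fin ne] by (intro SUP_upper)
  qed
  finally show ?thesis .
qed

end

theory Submission imports Defs "HOL-Combinatorics.Permutations" begin

text \<open>List the edges of an \<open>N\<close>-partite hypergraph as the columns of a matrix whose \<open>i\<close>-th row records
  the vertex in the \<open>i\<close>-th part. If no row separates \<open>t\<close> given columns, then each part contains at
  most \<open>t - 1\<close> vertices of the union of the corresponding edges, so this union has at most
  \<open>N * (t - 1)\<close> vertices. For the second bound, a random equipartition of the \<open>N * q\<close> vertices
  makes each edge transversal with probability \<open>q ^ N / (N * q choose N) \<ge> fact N / N ^ N\<close>,
  so some equipartition keeps at least this fraction of the edges.\<close>

section \<open>Elementary facts on hypergraphs\<close>

lemma G_free_subset: "G_free v e E \<Longrightarrow> F \<subseteq> E \<Longrightarrow> G_free v e F"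
  by (auto simp: G_free_def)

lemma G_free_empty: "0 < e \<Longrightarrow> G_free v e {}"
  by (auto simp: G_free_def)

lemma uniform_hypergraph_finite: "uniform_hypergraph r V E \<Longrightarrow> finite E"
  by (rule finite_subset[of _ "Pow V"]) (auto simp: uniform_hypergraph_def)

section \<open>From partite hypergraphs to hash families\<close>

lemma PHF_of_equipartite:
  assumes E: "equipartite_hypergraph N q P E" "G_free (t * N - N) t E" and pos: "0 < t" "0 < q"
  shows "\<exists>M. PHF N (card E) q t M"
proof -
  have sub: "A \<subseteq> (\<Union>i<N. P i)" if "A \<in> E" for A
    using E that by (auto simp: equipartite_hypergraph_def uniform_hypergraph_def)
  have one: "card (A \<inter> P i) = 1" if "A \<in> E" "i < N" for A i
    using E that by (auto simp: equipartite_hypergraph_def)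
  have cardP: "card (P i) = q" if "i < N" for i
    using E that by (auto simp: equipartite_hypergraph_def)
  have "finite E"
    using E uniform_hypergraph_finite by (auto simp: equipartite_hypergraph_def)
  then obtain h where h: "bij_betw h {0..<card E} E"
    using ex_bij_betw_nat_finite by blast
  have hE: "h j \<in> E" if "j < card E" for j
    using h that by (auto simp: bij_betw_def)
  \<comment> \<open>Each part is relabelled by \<open>{1..q}\<close>. Since infinite sets have
    \<open>card\<close> 0, \<open>0 < q\<close> guarantees that \<open>P i\<close> is
    finite.\<close>
  have "\<exists>f. bij_betw f (P i) {1..q}" if "i < N" for i
    using cardP[OF that] pos by (intro finite_same_card_bij) (auto intro: card_ge_0_finite)
  then obtain f where f: "\<And>i. i < N \<Longrightarrow> bij_betw (f i) (P i) {1..q}"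
    by metis
  define v where "v i j = the_elem (h j \<inter> P i)" for i j
  have v: "h j \<inter> P i = {v i j}" if "i < N" "j < card E" for i j
    using one[OF hE[OF that(2)] that(1)] unfolding v_def
    by (metis card_1_singletonE the_elem_eq)
  have "\<exists>i<N. inj_on (\<lambda>j. f i (v i j)) T" if T: "T \<subseteq> {..<card E}" "card T = t" for T
  proof (rule ccontr)
    assume not: "\<not> (\<exists>i<N. inj_on (\<lambda>j. f i (v i j)) T)"
    have finT: "finite T" using T finite_subset by blast
    have row: "card (v i ` T) \<le> t - 1" if i: "i < N" for i
    proof -
      have "v i j \<in> P i" if "j \<in> T" for j
        using v[OF i, of j] T(1) that by (metis IntE insertI1 lessThan_iff subsetD)
      then have "v i ` T \<subseteq> P i" by blast
      then have "inj_on (f i) (v i ` T)"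
        using f[OF i] by (meson bij_betw_def inj_on_subset)
      \<comment> \<open>The labelling \<open>f i\<close> is injective on \<open>P i\<close>, so a
        collision of labels in row \<open>i\<close> is already a collision of vertices.\<close>
      then have "\<not> inj_on (v i) T"
        using not i comp_inj_on[of "v i" T "f i"] unfolding comp_def by blast
      then have "card (v i ` T) \<noteq> t" using eq_card_imp_inj_on[OF finT, of "v i"] T(2) by auto
      then show ?thesis using card_image_le[OF finT, of "v i"] T(2) by linarith
    qed
    have "\<Union>(h ` T) \<subseteq> (\<Union>i<N. v i ` T)"
    proof
      fix x assume "x \<in> \<Union>(h ` T)"
      then obtain j where j: "j \<in> T" "x \<in> h j" by blast
      then have "j < card E" using T by auto
      then obtain i where "i < N" "x \<in> P i" using sub[OF hE] j by blast
      then show "x \<in> (\<Union>i<N. v i ` T)" using v \<open>j < card E\<close> j by blast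
    qed
    then have "card (\<Union>(h ` T)) \<le> card (\<Union>i<N. v i ` T)"
      by (rule card_mono[rotated]) (use finT in auto)
    also have "\<dots> \<le> (\<Sum>i<N. card (v i ` T))" by (rule card_UN_le) simp
    also have "\<dots> \<le> (\<Sum>i<N. t - 1)" using row by (intro sum_mono) auto
    also have "\<dots> = t * N - N" by (simp add: algebra_simps)
    finally have "card (\<Union>(h ` T)) \<le> t * N - N" .
    moreover have "inj_on h T" using h T by (auto simp: bij_betw_def lessThan_atLeast0 intro: inj_on_subset)
    then have "card (h ` T) = t" using T(2) by (simp add: card_image)
    then have "t * N - N + 1 \<le> card (\<Union>(h ` T))"
      using E(2) T(1) hE finT unfolding G_free_def by blast
    ultimately show False by linarith
  qed
  moreover have "f i (v i j) \<in> {1..q}" if "i < N" "j < card E" for i j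
    using v[OF that] f[OF that(1)] by (metis IntE bij_betwE singletonI)
  ultimately have "PHF N (card E) q t (\<lambda>i j. f i (v i j))"
    by (auto simp: PHF_def)
  then show ?thesis by blast
qed

section \<open>Equipartitions and their transversals\<close>

lemma exists_equipartition:
  assumes "card V = r * q" "finite V"
  shows "\<exists>P :: nat \<Rightarrow> 'a set. disjoint_family_on P {..<r} \<and> (\<forall>i<r. card (P i) = q) \<and> (\<Union>i<r. P i) = V"
proof -
  have "card ({..<r} \<times> {..<q}) = card V" using assms by simp
  then obtain h where h: "bij_betw h ({..<r} \<times> {..<q}) V"
    using assms finite_same_card_bij by (metis finite_SigmaI finite_lessThan)
  define P where "P i = h ` ({i} \<times> {..<q})" for i
  have inj: "inj_on h ({..<r} \<times> {..<q})" using h by (simp add: bij_betw_def)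
  have "disjoint_family_on P {..<r}"
    using inj unfolding disjoint_family_on_def P_def inj_on_def by fastforce
  moreover have "card (P i) = q" if "i < r" for i
  proof -
    have "inj_on h ({i} \<times> {..<q})" by (rule inj_on_subset[OF inj]) (use that in auto)
    then show ?thesis unfolding P_def by (simp add: card_image card_cartesian_product)
  qed
  moreover have "(\<Union>i<r. P i) = h ` ({..<r} \<times> {..<q})" by (auto simp: P_def)
  then have "(\<Union>i<r. P i) = V" using h by (simp add: bij_betw_def)
  ultimately show ?thesis by blast
qed

text \<open>Choosing one vertex from each part gives a transversal, and disjointness of the parts
  lets the choice be read off from its range. Hence the \<open>q ^ r\<close> choice functions inject
  into the transversals; the averaging needs only this lower bound.\<close>

lemma card_transversals_ge:
  fixes P :: "nat \<Rightarrow> 'a set"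
  assumes disj: "disjoint_family_on P {..<r}" and card: "\<And>i. i < r \<Longrightarrow> card (P i) = q"
    and fin: "finite (\<Union>i<r. P i)"
  shows "q ^ r \<le> card {B. B \<subseteq> (\<Union>i<r. P i) \<and> card B = r \<and> (\<forall>i<r. card (B \<inter> P i) = 1)}"
    (is "_ \<le> card ?T")
proof -
  let ?F = "PiE {..<r} P"
  have idx: "i = j" if "i < r" "j < r" "x \<in> P i" "x \<in> P j" for i j x
    using disj that by (auto simp: disjoint_family_on_def)
  have "g ` {..<r} \<in> ?T" if g: "g \<in> ?F" for g
  proof -
    have gP: "g i \<in> P i" if "i < r" for i using g that by auto
    have "inj_on g {..<r}" using gP idx by (metis inj_onI lessThan_iff)
    moreover have "g ` {..<r} \<inter> P i = {g i}" if "i < r" for i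
      using gP idx that by blast
    ultimately show ?thesis using gP by (auto simp: card_image)
  qed
  moreover have "inj_on (\<lambda>g. g ` {..<r}) ?F"
  proof (rule inj_onI)
    fix g g' assume g: "g \<in> ?F" "g' \<in> ?F" "g ` {..<r} = g' ` {..<r}"
    show "g = g'"
    proof (rule PiE_ext[OF g(1,2)])
      fix i assume i: "i \<in> {..<r}"
      then obtain j where j: "j < r" "g i = g' j" using g(3) by blast
      then have "i = j" using g i idx[of i j "g i"] by (metis PiE_mem lessThan_iff)
      then show "g i = g' i" using j by simp
    qed
  qed
  moreover have "finite ?T" by (rule finite_subset[of _ "Pow (\<Union>i<r. P i)"]) (use fin in auto)
  ultimately have "card ?F \<le> card ?T" by (intro card_inj_on_le) auto
  then show ?thesis using card by (simp add: card_PiE)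
qed

section \<open>Permutations acting on subsets, and averaging over them\<close>

lemma exists_permutes_image_eq:
  assumes "finite V" "A \<subseteq> V" "B \<subseteq> V" "card A = card B"
  shows "\<exists>p. p permutes V \<and> p ` A = B"
proof -
  have fin: "finite A" "finite B" using assms finite_subset by auto
  then obtain f where f: "bij_betw f A B" using assms finite_same_card_bij by blast
  have "card (V - A) = card (V - B)" using assms fin by (simp add: card_Diff_subset)
  then obtain g where g: "bij_betw g (V - A) (V - B)"
    using assms finite_same_card_bij by blast
  \<comment> \<open>A bijection from \<open>A\<close> to \<open>B\<close> is glued to one between
    the complements; outside \<open>V\<close> the map is the identity, as \<open>permutes\<close>
    requires.\<close>
  define p where "p x = (if x \<in> A then f x else if x \<in> V then g x else x)" for x
  have "bij_betw p A B" using f by (rule bij_betw_cong[THEN iffD1, rotated]) (simp add: p_def)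
  moreover have "bij_betw p (V - A) (V - B)"
    using g by (rule bij_betw_cong[THEN iffD1, rotated]) (simp add: p_def)
  ultimately have "bij_betw p (A \<union> (V - A)) (B \<union> (V - B))" "p ` A = B"
    by (blast intro: bij_betw_combine, blast dest: bij_betw_imp_surj_on)
  moreover have "A \<union> (V - A) = V" "B \<union> (V - B) = V" using assms by auto
  moreover have "p x = x" if "x \<notin> V" for x using that assms by (auto simp: p_def)
  ultimately show ?thesis by (metis bij_imp_permutes)
qed

text \<open>A uniformly random permutation sends \<open>A\<close> to every \<open>k\<close>-subset
  with the same probability. The product form avoids division.\<close>

lemma card_permutes_image_eq:
  assumes V: "finite V" and A: "A \<subseteq> V" "card A = k" and B: "B \<subseteq> V" "card B = k"
  shows "card {p. p permutes V \<and> p ` A = B} * (card V choose k) = fact (card V)"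
proof -
  let ?K = "\<lambda>C. {p. p permutes V \<and> p ` A = C}"
  let ?S = "{C. C \<subseteq> V \<and> card C = k}"
  have fin: "finite (?K C)" for C
    by (rule finite_subset[OF _ finite_permutations[OF V]]) auto
  have finS: "finite ?S" using V by simp
  \<comment> \<open>Composing with a permutation that carries \<open>C\<close> to \<open>D\<close>
    injects the fibre over \<open>C\<close> into the fibre over \<open>D\<close>. Exchanging the
    roles of the two sets shows that all fibres have equal size.\<close>
  have le: "card (?K C) \<le> card (?K D)" if CD: "C \<in> ?S" "D \<in> ?S" for C D
  proof -
    obtain s where s: "s permutes V" "s ` C = D"
      using exists_permutes_image_eq[OF V, of C D] CD by auto
    have "inj_on ((\<circ>) s) (?K C)"
      using permutes_inj[OF s(1)] by (auto simp: inj_on_def fun_eq_iff inj_def)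
    moreover have "(\<circ>) s ` ?K C \<subseteq> ?K D"
      using s by (auto simp: permutes_compose image_comp[symmetric])
    ultimately show ?thesis using fin by (rule card_inj_on_le)
  qed
  have eq: "card (?K C) = card (?K B)" if "C \<in> ?S" for C
    using le[of C B] le[of B C] that B by auto
  have "{p. p permutes V} = (\<Union>C\<in>?S. ?K C)"
  proof -
    have "p ` A \<subseteq> V \<and> card (p ` A) = k" if "p permutes V" for p
      using that A by (metis permutes_image image_mono card_image permutes_inj_on)
    then show ?thesis by auto
  qed
  then have "fact (card V) = card (\<Union>C\<in>?S. ?K C)"
    using card_permutations[OF refl V] by simp
  also have "\<dots> = (\<Sum>C\<in>?S. card (?K C))"
    using finS fin by (intro card_UN_disjoint) auto
  also have "\<dots> = card ?S * card (?K B)" using eq by simp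
  also have "card ?S = card V choose k" using V by (rule n_subsets)
  finally show ?thesis by (simp add: mult.commute)
qed

text \<open>First-moment argument: a random permutation moves each edge into \<open>T\<close> with
  probability \<open>card T / (card V choose k)\<close>, and some permutation does at least as well
  as the expected number of such edges.\<close>

lemma exists_permutes_many_edges_into:
  assumes V: "finite V" and E: "\<And>A. A \<in> E \<Longrightarrow> A \<subseteq> V \<and> card A = k"
    and T: "\<And>B. B \<in> T \<Longrightarrow> B \<subseteq> V \<and> card B = k"
  shows "\<exists>p. p permutes V \<and> card E * card T \<le> card {A \<in> E. p ` A \<in> T} * (card V choose k)"
proof (rule ccontr)
  assume "\<not> ?thesis"
  then have less: "card {A \<in> E. p ` A \<in> T} * (card V choose k) < card E * card T"
    if "p permutes V" for p using that by (meson not_le_imp_less)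
  let ?S = "{p. p permutes V}"
  have finS: "finite ?S" using V by (rule finite_permutations)
  have "E \<subseteq> Pow V" "T \<subseteq> Pow V" using E T by blast+
  then have finE: "finite E" and finT: "finite T"
    using V by (meson finite_Pow_iff finite_subset)+
  have hit: "(\<Sum>p\<in>?S. of_bool (p ` A \<in> T)) * (card V choose k) = card T * fact (card V)"
    if A: "A \<in> E" for A
  proof -
    have "(\<Sum>p\<in>?S. of_bool (p ` A \<in> T)) = (\<Sum>p\<in>?S. \<Sum>B\<in>T. of_bool (p ` A = B) :: nat)"
      using finT by (intro sum.cong refl) (simp add: of_bool_def sum.delta')
    also have "\<dots> = (\<Sum>B\<in>T. \<Sum>p\<in>?S. of_bool (p ` A = B))" by (rule sum.swap)
    also have "\<dots> = (\<Sum>B\<in>T. card {p. p permutes V \<and> p ` A = B})"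
      using finS by (simp add: sum_of_bool_eq Int_def)
    finally have "(\<Sum>p\<in>?S. of_bool (p ` A \<in> T)) * (card V choose k)
        = (\<Sum>B\<in>T. card {p. p permutes V \<and> p ` A = B} * (card V choose k))"
      by (simp add: sum_distrib_right)
    also have "\<dots> = (\<Sum>B\<in>T. fact (card V))"
      using E[OF A] T V by (intro sum.cong refl card_permutes_image_eq) auto
    finally show ?thesis by simp
  qed
  \<comment> \<open>Pairs of a permutation and an edge it moves into \<open>T\<close> are counted in
    both orders.\<close>
  have "(\<Sum>p\<in>?S. card {A \<in> E. p ` A \<in> T} * (card V choose k))
      = (\<Sum>p\<in>?S. \<Sum>A\<in>E. of_bool (p ` A \<in> T)) * (card V choose k)"
    using finE by (simp add: sum_distrib_right sum_of_bool_eq Int_def)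
  also have "\<dots> = (\<Sum>A\<in>E. (\<Sum>p\<in>?S. of_bool (p ` A \<in> T)) * (card V choose k))"
    by (subst sum.swap) (simp add: sum_distrib_right)
  also have "\<dots> = (\<Sum>A\<in>E. card T * fact (card V))" by (intro sum.cong refl hit)
  also have "\<dots> = (\<Sum>p\<in>?S. card E * card T)"
    using card_permutations[OF refl V] by simp
  finally have "(\<Sum>p\<in>?S. card {A \<in> E. p ` A \<in> T} * (card V choose k)) = (\<Sum>p\<in>?S. card E * card T)" .
  \<comment> \<open>Strict inequality of the sums needs a nonempty index set, which the identity
    provides.\<close>
  moreover have "id \<in> ?S" by (simp add: permutes_id)
  then have "(\<Sum>p\<in>?S. card {A \<in> E. p ` A \<in> T} * (card V choose k)) < (\<Sum>p\<in>?S. card E * card T)"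
    using finS less by (intro sum_strict_mono) blast+
  ultimately show False by simp
qed

section \<open>Dense equipartite subhypergraphs\<close>

lemma exists_equipartite_subhypergraph:
  fixes V :: "'a set"
  assumes V: "card V = N * q" and E: "uniform_hypergraph N V E" and q: "0 < q"
  shows "\<exists>P F. F \<subseteq> E \<and> equipartite_hypergraph N q P F \<and> fact N * card E \<le> N ^ N * card F"
proof -
  have fin: "finite V" using E by (simp add: uniform_hypergraph_def)
  obtain P :: "nat \<Rightarrow> 'a set" where P: "disjoint_family_on P {..<N}"
    "\<And>i. i < N \<Longrightarrow> card (P i) = q" "(\<Union>i<N. P i) = V"
    using exists_equipartition[OF V fin] by auto
  define T where "T = {B. B \<subseteq> V \<and> card B = N \<and> (\<forall>i<N. card (B \<inter> P i) = 1)}"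
  have T: "q ^ N \<le> card T"
    using card_transversals_ge[OF P(1,2)] P(3) fin by (simp add: T_def)
  obtain p where p: "p permutes V"
    "card E * card T \<le> card {A \<in> E. p ` A \<in> T} * (card V choose N)"
    using exists_permutes_many_edges_into[OF fin, of E N T] E
    unfolding T_def uniform_hypergraph_def by blast
  define F where "F = {A \<in> E. p ` A \<in> T}"
  define Q where "Q i = inv p ` P i" for i
  have invp: "inv p permutes V" using p(1) by (rule permutes_inv)
  have inj: "inj (inv p)" "inj p" using invp p(1) by (auto intro: permutes_inj)
  have UQ: "(\<Union>i<N. Q i) = V"
    using P(3) permutes_image[OF invp] by (simp add: Q_def image_UN[symmetric])
  have "card (A \<inter> Q i) = 1" if "A \<in> F" "i < N" for A i
  proof -
    have "p ` (A \<inter> Q i) = p ` A \<inter> P i"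
      unfolding Q_def image_Int[OF inj(2)] image_image permutes_inverses(1)[OF p(1)] by simp
    then have "card (A \<inter> Q i) = card (p ` A \<inter> P i)"
      by (metis card_image inj(2) inj_on_subset subset_UNIV)
    then show ?thesis using that by (auto simp: F_def T_def)
  qed
  moreover have "disjoint_family_on Q {..<N}"
    using P(1) by (simp add: disjoint_family_on_def Q_def image_Int[OF inj(1), symmetric])
  moreover have "card (Q i) = q" if "i < N" for i
    using P(2)[OF that] inj(1) by (simp add: Q_def card_image inj_on_subset)
  moreover have "uniform_hypergraph N V F"
    using E by (auto simp: uniform_hypergraph_def F_def)
  ultimately have equi: "equipartite_hypergraph N q Q F"
    using UQ by (simp add: equipartite_hypergraph_def)
  \<comment> \<open>The factor \<open>q ^ N\<close> comes from the count of transversals. It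
    reappears in \<open>(N * q) ^ N\<close>, which bounds \<open>(card V choose N) * fact N\<close>,
    and cancels because \<open>q\<close> is positive.\<close>
  have "q ^ N * (fact N * card E) \<le> fact N * (card E * card T)"
    using mult_right_mono[OF T, of "fact N * card E"] by (simp add: ac_simps)
  also have "\<dots> \<le> fact N * (card F * (card V choose N))"
    using p(2) by (simp add: F_def)
  also have "\<dots> = card F * ((card V choose N) * fact N)" by simp
  also have "\<dots> \<le> card F * (card V) ^ N"
    by (rule mult_left_mono[OF binomial_fact_pow]) simp
  also have "\<dots> = q ^ N * (N ^ N * card F)" using V by (simp add: power_mult_distrib)
  finally have "fact N * card E \<le> N ^ N * card F" using q by simp
  moreover have "F \<subseteq> E" by (simp add: F_def)
  ultimately show ?thesis using equi by blast
qed

section \<open>Attained extremal numbers and the two bounds\<close>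

lemma f_star_max_ge:
  fixes P :: "nat \<Rightarrow> nat set"
  assumes "equipartite_hypergraph r q P E" "G_free v e E"
  shows "card E \<le> f_star_max r q v e"
  unfolding f_star_max_def using assms by (intro Max_ge finite_f_star_max_set) blast

text \<open>\<open>Max\<close> is meaningful only on a nonempty set. For \<open>0 < e\<close> the
  empty hypergraph is vacuously free, and an equipartition of \<open>{..<r * q}\<close> supplies
  parts for it.\<close>

lemma f_star_max_attained:
  assumes "0 < e"
  obtains P :: "nat \<Rightarrow> nat set" and E
  where "equipartite_hypergraph r q P E" "G_free v e E" "card E = f_star_max r q v e"
proof -
  let ?S = "{card E |(P :: nat \<Rightarrow> nat set) E. equipartite_hypergraph r q P E \<and> G_free v e E}"
  obtain P :: "nat \<Rightarrow> nat set" where P: "disjoint_family_on P {..<r}"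
    "\<forall>i<r. card (P i) = q" "(\<Union>i<r. P i) = {..<r * q}"
    using exists_equipartition[of "{..<r * q}" r q] by auto
  then have "equipartite_hypergraph r q P {}"
    by (simp add: equipartite_hypergraph_def uniform_hypergraph_def)
  then have "?S \<noteq> {}" using G_free_empty[OF assms] by blast
  then have "f_star_max r q v e \<in> ?S"
    unfolding f_star_max_def by (rule Max_in[OF finite_f_star_max_set])
  then show thesis using that by auto
qed

lemma f_max_attained:
  assumes "0 < e"
  obtains V :: "nat set" and E
  where "card V = n" "uniform_hypergraph r V E" "G_free v e E" "card E = f_max r n v e"
proof -
  let ?S = "{card E |(V :: nat set) E. card V = n \<and> uniform_hypergraph r V E \<and> G_free v e E}"
  have "card {..<n} = n" "uniform_hypergraph r {..<n} {}"
    by (auto simp: uniform_hypergraph_def)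
  then have "?S \<noteq> {}" using G_free_empty[OF assms] by blast
  then have "f_max r n v e \<in> ?S"
    unfolding f_max_def by (rule Max_in[OF finite_f_max_set])
  then show thesis using that by auto
qed

theorem theorem7p1:
  fixes t N q :: nat
  assumes "0 < t" and "0 < N" and "0 < q"
  shows "enat (f_star_max N q (t * N - N) t) \<le> phf_max t N q \<and>
    ereal (fact N / real N ^ N * real (f_max N (N * q) (t * N - N) t))
      \<le> ereal_of_enat (phf_max t N q)"
proof
  let ?v = "t * N - N"
  obtain P :: "nat \<Rightarrow> nat set" and E where E: "equipartite_hypergraph N q P E"
    "G_free ?v t E" "card E = f_star_max N q ?v t"
    using f_star_max_attained[OF assms(1)] .
  show star: "enat (f_star_max N q ?v t) \<le> phf_max t N q"
    unfolding phf_max_def using PHF_of_equipartite[OF E(1,2) assms(1,3)] E(3)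
    by (intro Sup_upper) auto
  \<comment> \<open>The second bound reduces to the first: an optimal \<open>H\<close> contains a
    dense equipartite subhypergraph, which inherits freeness and so has at most
    \<open>f_star_max\<close> edges.\<close>
  obtain V :: "nat set" and H where H: "card V = N * q" "uniform_hypergraph N V H"
    "G_free ?v t H" "card H = f_max N (N * q) ?v t"
    using f_max_attained[OF assms(1)] .
  obtain Q F where F: "F \<subseteq> H" "equipartite_hypergraph N q Q F"
    "fact N * card H \<le> N ^ N * card F"
    using exists_equipartite_subhypergraph[OF H(1,2) assms(3)] by blast
  have "card F \<le> f_star_max N q ?v t"
    using f_star_max_ge[OF F(2)] G_free_subset[OF H(3) F(1)] by blast
  then have "fact N * card H \<le> N ^ N * f_star_max N q ?v t"
    using F(3) by (meson le_trans mult_le_mono2)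
  then have "real (fact N * card H) \<le> real (N ^ N * f_star_max N q ?v t)"
    by (rule of_nat_mono)
  then have "fact N / real N ^ N * real (card H) \<le> real (f_star_max N q ?v t)"
    using assms(2) by (simp add: field_simps)
  then have "ereal (fact N / real N ^ N * real (f_max N (N * q) ?v t))
      \<le> ereal_of_enat (enat (f_star_max N q ?v t))"
    using H(4) by simp
  also have "\<dots> \<le> ereal_of_enat (phf_max t N q)"
    using star by (simp only: ereal_of_enat_le_iff)
  finally show "ereal (fact N / real N ^ N * real (f_max N (N * q) ?v t))
      \<le> ereal_of_enat (phf_max t N q)" .
qed

end
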